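(* Let $G$ be a topological group, let $p\colon E\to B$ be a $G$-fibration, and let $\overline{p}\colon\overline{E}\to\overline{B}$ be the induced map between the orbit spaces $\overline{E}=E/G$ and $\overline{B}=B/G$. Then $$\mathrm{secat}(\overline{p})\le\mathrm{secat}_G(p).$$
   Context: All $G$-spaces are Hausdorff. A $G$-map is a continuous equivariant map; a $G$-homotopy is an equivariant homotopy ($G$ acting trivially on $[0,1]$). A $G$-fibration is a $G$-map with the $G$-homotopy lifting property with respect to every $G$-space. Equivariant sectional category: for a $G$-map $p\colon E\to B$, $\mathrm{secat}_G(p)$ is the least positive integer $k$ such that $B$ has a cover by $G$-invariant open sets $U_1,\dots,U_k$ with $G$-maps $s_i\colon U_i\to E$ such that $p\circ s_i$ is $G$-homotopic to the inclusion $U_i\hookrightarrow B$ ($\infty$ if there is no such $k$). The sectional category $\mathrm{secat}$ of a continuous map is the same invariant for the trivial group. *)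

theory Defs
  imports "HOL-Analysis.Analysis" "HOL-Algebra.Group_Action" "HOL-Algebra.Elementary_Groups"
begin

section \<open>Topological groups, G-spaces and G-maps\<close>

definition topological_group :: "('g, 'm) monoid_scheme \<Rightarrow> 'g topology \<Rightarrow> bool" where
  "topological_group G T \<longleftrightarrow>
     group G \<and> topspace T = carrier G \<and>
     continuous_map (prod_topology T T) T (\<lambda>(g, h). g \<otimes>\<^bsub>G\<^esub> h) \<and>
     continuous_map T T (\<lambda>g. inv\<^bsub>G\<^esub> g)"

definition G_space ::
  "('g, 'm) monoid_scheme \<Rightarrow> 'g topology \<Rightarrow> 'x topology \<Rightarrow> ('g \<Rightarrow> 'x \<Rightarrow> 'x) \<Rightarrow> bool" where
  "G_space G T X \<phi> \<longleftrightarrow>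
     Hausdorff_space X \<and> group_action G (topspace X) \<phi> \<and>
     continuous_map (prod_topology T X) X (\<lambda>(g, x). \<phi> g x)"

definition equivariant_on ::
  "('g, 'm) monoid_scheme \<Rightarrow> 'x set \<Rightarrow> ('g \<Rightarrow> 'x \<Rightarrow> 'x) \<Rightarrow> ('g \<Rightarrow> 'y \<Rightarrow> 'y) \<Rightarrow> ('x \<Rightarrow> 'y) \<Rightarrow> bool" where
  "equivariant_on G S \<phi> \<psi> f \<longleftrightarrow> (\<forall>g\<in>carrier G. \<forall>x\<in>S. f (\<phi> g x) = \<psi> g (f x))"

definition G_map ::
  "('g, 'm) monoid_scheme \<Rightarrow> 'x topology \<Rightarrow> ('g \<Rightarrow> 'x \<Rightarrow> 'x) \<Rightarrow> 'y topology \<Rightarrow> ('g \<Rightarrow> 'y \<Rightarrow> 'y) \<Rightarrow>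
   ('x \<Rightarrow> 'y) \<Rightarrow> bool" where
  "G_map G X \<phi> Y \<psi> f \<longleftrightarrow> continuous_map X Y f \<and> equivariant_on G (topspace X) \<phi> \<psi> f"

text \<open>As in \<^const>\<open>homotopic_with\<close>, the interval is the first factor. Since the group acts
  trivially on it, a map out of the product is equivariant iff every stage is.\<close>

definition G_homotopy ::
  "('g, 'm) monoid_scheme \<Rightarrow> 'x topology \<Rightarrow> ('g \<Rightarrow> 'x \<Rightarrow> 'x) \<Rightarrow> 'y topology \<Rightarrow> ('g \<Rightarrow> 'y \<Rightarrow> 'y) \<Rightarrow>
   (real \<times> 'x \<Rightarrow> 'y) \<Rightarrow> bool" where
  "G_homotopy G X \<phi> Y \<psi> h \<longleftrightarrow>
     continuous_map (prod_topology (top_of_set {0..1}) X) Y h \<and>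
     (\<forall>t\<in>{0..1}. equivariant_on G (topspace X) \<phi> \<psi> (\<lambda>x. h (t, x)))"

definition G_homotopic ::
  "('g, 'm) monoid_scheme \<Rightarrow> 'x topology \<Rightarrow> ('g \<Rightarrow> 'x \<Rightarrow> 'x) \<Rightarrow> 'y topology \<Rightarrow> ('g \<Rightarrow> 'y \<Rightarrow> 'y) \<Rightarrow>
   ('x \<Rightarrow> 'y) \<Rightarrow> ('x \<Rightarrow> 'y) \<Rightarrow> bool" where
  "G_homotopic G X \<phi> Y \<psi> = homotopic_with (equivariant_on G (topspace X) \<phi> \<psi>) X Y"

lemma G_homotopic_iff:
  "G_homotopic G X \<phi> Y \<psi> f f' \<longleftrightarrow>
     (\<exists>h. G_homotopy G X \<phi> Y \<psi> h \<and> (\<forall>x. h (0, x) = f x) \<and> (\<forall>x. h (1, x) = f' x))"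
  unfolding G_homotopic_def homotopic_with_def G_homotopy_def by blast


section \<open>G-fibrations\<close>

definition G_homotopy_lifting ::
  "('g, 'm) monoid_scheme \<Rightarrow> 'e topology \<Rightarrow> ('g \<Rightarrow> 'e \<Rightarrow> 'e) \<Rightarrow> 'b topology \<Rightarrow> ('g \<Rightarrow> 'b \<Rightarrow> 'b) \<Rightarrow>
   ('e \<Rightarrow> 'b) \<Rightarrow> 'x topology \<Rightarrow> ('g \<Rightarrow> 'x \<Rightarrow> 'x) \<Rightarrow> bool" where
  "G_homotopy_lifting G E \<phi> B \<psi> p X \<xi> \<longleftrightarrow>
     (\<forall>f h. G_map G X \<xi> E \<phi> f \<and> G_homotopy G X \<xi> B \<psi> h \<and>
            (\<forall>x\<in>topspace X. h (0, x) = p (f x)) \<longrightarrow>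
        (\<exists>k. G_homotopy G X \<xi> E \<phi> k \<and>
             (\<forall>x\<in>topspace X. k (0, x) = f x) \<and>
             (\<forall>t\<in>{0..1}. \<forall>x\<in>topspace X. p (k (t, x)) = h (t, x))))"

text \<open>A definition cannot quantify over all types of test spaces. It is enough to let the test
  spaces range over the one type \<open>'e \<times> (real \<Rightarrow> 'b)\<close>, because it carries the universal lifting
  problem, on the space of pairs \<open>(e, \<gamma>)\<close> of a point \<open>e\<close> of \<open>E\<close> and a path \<open>\<gamma>\<close> in \<open>B\<close> starting at
  \<open>p e\<close>. Theorem \<open>G_fibration_lifting\<close> below proves that the lifting property then holds for
  every G-space, over any type.\<close>

definition G_fibration ::
  "('g, 'm) monoid_scheme \<Rightarrow> 'g topology \<Rightarrow> 'e topology \<Rightarrow> ('g \<Rightarrow> 'e \<Rightarrow> 'e) \<Rightarrow>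
   'b topology \<Rightarrow> ('g \<Rightarrow> 'b \<Rightarrow> 'b) \<Rightarrow> ('e \<Rightarrow> 'b) \<Rightarrow> bool" where
  "G_fibration G T E \<phi> B \<psi> p \<longleftrightarrow>
     G_map G E \<phi> B \<psi> p \<and>
     (\<forall>(X :: ('e \<times> (real \<Rightarrow> 'b)) topology) \<xi>.
        G_space G T X \<xi> \<longrightarrow> G_homotopy_lifting G E \<phi> B \<psi> p X \<xi>)"


subsection \<open>The universal lifting problem\<close>

definition path_pairs :: "'e topology \<Rightarrow> 'b topology \<Rightarrow> ('e \<Rightarrow> 'b) \<Rightarrow> ('e \<times> (real \<Rightarrow> 'b)) set" where
  "path_pairs E B p = {(e, \<gamma>). e \<in> topspace E \<and> \<gamma> \<in> extensional {0..1} \<and>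
      continuous_map (top_of_set {0..1}) B \<gamma> \<and> \<gamma> 0 = p e}"

text \<open>The topology induced by that of \<open>E\<close> and the compact-open topology on paths.\<close>

definition path_pair_subbase ::
  "'e topology \<Rightarrow> 'b topology \<Rightarrow> ('e \<Rightarrow> 'b) \<Rightarrow> ('e \<times> (real \<Rightarrow> 'b)) set set" where
  "path_pair_subbase E B p =
     {{z \<in> path_pairs E B p. fst z \<in> U} |U. openin E U} \<union>
     {{z \<in> path_pairs E B p. \<forall>t\<in>K. snd z t \<in> V} |K V. compact K \<and> K \<subseteq> {0..1} \<and> openin B V}"

definition path_pair_space ::
  "'e topology \<Rightarrow> 'b topology \<Rightarrow> ('e \<Rightarrow> 'b) \<Rightarrow> ('e \<times> (real \<Rightarrow> 'b)) topology" where
  "path_pair_space E B p = topology_generated_by (path_pair_subbase E B p)"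

definition path_pair_action ::
  "'e topology \<Rightarrow> ('g \<Rightarrow> 'e \<Rightarrow> 'e) \<Rightarrow> 'b topology \<Rightarrow> ('g \<Rightarrow> 'b \<Rightarrow> 'b) \<Rightarrow> ('e \<Rightarrow> 'b) \<Rightarrow>
   'g \<Rightarrow> 'e \<times> (real \<Rightarrow> 'b) \<Rightarrow> 'e \<times> (real \<Rightarrow> 'b)" where
  "path_pair_action E \<phi> B \<psi> p g =
     (\<lambda>z\<in>path_pairs E B p. (\<phi> g (fst z), \<lambda>t\<in>{0..1}. \<psi> g (snd z t)))"

lemma topspace_path_pair_space [simp]: "topspace (path_pair_space E B p) = path_pairs E B p"
proof -
  have "path_pairs E B p \<in> path_pair_subbase E B p"
    unfolding path_pair_subbase_def path_pairs_def by (auto intro!: exI[of _ "topspace E"])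
  then show ?thesis
    unfolding path_pair_space_def topology_generated_by_topspace
    by (auto simp: path_pair_subbase_def)
qed

lemma openin_path_pair_fst:
  "openin E U \<Longrightarrow> openin (path_pair_space E B p) {z \<in> path_pairs E B p. fst z \<in> U}"
  unfolding path_pair_space_def path_pair_subbase_def
  by (rule topology_generated_by_Basis) blast

lemma openin_path_pair_snd:
  "\<lbrakk>compact K; K \<subseteq> {0..1}; openin B V\<rbrakk> \<Longrightarrow>
     openin (path_pair_space E B p) {z \<in> path_pairs E B p. \<forall>t\<in>K. snd z t \<in> V}"
  unfolding path_pair_space_def path_pair_subbase_def
  by (rule topology_generated_by_Basis) blast

lemma continuous_map_path_pair_fst: "continuous_map (path_pair_space E B p) E fst"
  unfolding continuous_map_def
  by (auto simp: openin_path_pair_fst) (auto simp: path_pairs_def)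

lemma continuous_map_path_pair_eval:
  "continuous_map (prod_topology (top_of_set {0..1}) (path_pair_space E B p)) B
     (\<lambda>(t, z). snd z t)"
  unfolding continuous_map_atin
proof (intro ballI)
  fix w assume "w \<in> topspace (prod_topology (top_of_set {0..1::real}) (path_pair_space E B p))"
  then obtain t z where w: "w = (t, z)" and t: "t \<in> {0..1::real}" and z: "z \<in> path_pairs E B p"
    by auto
  have cont: "continuous_map (top_of_set {0..1}) B (snd z)"
    using z by (auto simp: path_pairs_def)
  show "limitin B (\<lambda>(t, z). snd z t) ((\<lambda>(t, z). snd z t) w)
      (atin (prod_topology (top_of_set {0..1}) (path_pair_space E B p)) w)"
    unfolding limitin_def
  proof (intro conjI allI impI)
    show "(\<lambda>(t, z). snd z t) w \<in> topspace B"
      using cont t by (auto simp: w continuous_map_def Pi_iff)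
  next
    fix V assume V: "openin B V \<and> (\<lambda>(t, z). snd z t) w \<in> V"
    have "openin (top_of_set {0..1}) {s \<in> {0..1}. snd z s \<in> V}"
      using openin_continuous_map_preimage[OF cont, of V] V by simp
    then obtain e where e: "e > 0" "\<And>s. s \<in> {0..1} \<Longrightarrow> dist s t < e \<Longrightarrow> snd z s \<in> V"
      using t V unfolding openin_euclidean_subtopology_iff w by auto
    define K where "K = {0..1} \<inter> cball t (e/2)"
    define N where "N = ({0..1} \<inter> ball t (e/2)) \<times> {z \<in> path_pairs E B p. \<forall>s\<in>K. snd z s \<in> V}"
    have "openin (prod_topology (top_of_set {0..1}) (path_pair_space E B p)) N"
      unfolding N_def
      by (intro openin_prod_Times_iff[THEN iffD2] disjI2 conjI openin_path_pair_snd)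
         (use V in \<open>auto simp: K_def compact_Int_closed openin_open\<close>)
    moreover have "w \<in> N"
      using e t z by (auto simp: N_def K_def w dist_commute)
    moreover have "(\<lambda>(t, z). snd z t) v \<in> V" if "v \<in> N" for v
      using that by (auto simp: N_def K_def)
    ultimately show "\<forall>\<^sub>F v in atin (prod_topology (top_of_set {0..1}) (path_pair_space E B p)) w.
        (\<lambda>(t, z). snd z t) v \<in> V"
      unfolding eventually_atin by blast
  qed
qed

lemma continuous_map_into_path_pair_space:
  assumes f: "continuous_map Y E (\<lambda>y. fst (F y))"
    and h: "continuous_map (prod_topology (top_of_set {0..1}) Y) B (\<lambda>(t, y). snd (F y) t)"
    and F: "\<And>y. y \<in> topspace Y \<Longrightarrow> F y \<in> path_pairs E B p"
  shows "continuous_map Y (path_pair_space E B p) F"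
  unfolding path_pair_space_def continuous_on_generated_topo_iff
proof (intro conjI allI impI)
  show "F ` topspace Y \<subseteq> \<Union> (path_pair_subbase E B p)"
    using F topspace_path_pair_space[of E B p, unfolded path_pair_space_def]
    unfolding topology_generated_by_topspace by auto
next
  fix S assume "S \<in> path_pair_subbase E B p"
  then consider (fst) U where "openin E U" "S = {z \<in> path_pairs E B p. fst z \<in> U}"
    | (snd) K V where "compact K" "K \<subseteq> {0..1}" "openin B V"
        "S = {z \<in> path_pairs E B p. \<forall>t\<in>K. snd z t \<in> V}"
    unfolding path_pair_subbase_def by blast
  then show "openin Y (F -` S \<inter> topspace Y)"
  proof cases
    case fst
    have "F -` S \<inter> topspace Y = {y \<in> topspace Y. fst (F y) \<in> U}"
      using fst F by auto
    then show ?thesis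
      using openin_continuous_map_preimage[OF f fst(1)] by simp
  next
    case snd
    have "continuous_map (prod_topology (top_of_set K) Y) B (\<lambda>(t, y). snd (F y) t)"
    proof -
      have "prod_topology (top_of_set K) Y =
          subtopology (prod_topology (top_of_set {0..1}) Y) (K \<times> UNIV)"
      proof -
        have "{0..1} \<times> topspace Y \<inter> K \<times> UNIV = K \<times> topspace Y"
          using snd(2) by auto
        then show ?thesis
          by (simp add: prod_topology_subtopology subtopology_subtopology)
      qed
      then show ?thesis
        using continuous_map_from_subtopology[OF h] by simp
    qed
    moreover have "closedin B (topspace B - V)"
      using snd by blast
    ultimately have "closedin (prod_topology (top_of_set K) Y)
        {w \<in> topspace (prod_topology (top_of_set K) Y). (\<lambda>(t, y). snd (F y) t) w \<in> topspace B - V}"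
      by (rule closedin_continuous_map_preimage)
    moreover have "closed_map (prod_topology (top_of_set K) Y) Y snd"
      using snd(1) by (intro closed_map_snd) (simp add: compact_space_subtopology)
    ultimately have cl: "closedin Y (snd ` {w \<in> topspace (prod_topology (top_of_set K) Y).
        (\<lambda>(t, y). snd (F y) t) w \<in> topspace B - V})"
      unfolding closed_map_def by blast
    have inB: "snd (F y) t \<in> topspace B" if "y \<in> topspace Y" "t \<in> K" for y t
      using h that snd(2) by (force simp: continuous_map_def Pi_iff)
    have "F -` S \<inter> topspace Y = topspace Y - snd ` {w \<in> topspace (prod_topology (top_of_set K) Y).
        (\<lambda>(t, y). snd (F y) t) w \<in> topspace B - V}"
      using F inB snd(4) by (force simp: image_iff)
    then show ?thesis
      using cl by (simp add: openin_diff)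
  qed
qed

lemma Hausdorff_path_pair_space:
  assumes E: "Hausdorff_space E" and B: "Hausdorff_space B"
  shows "Hausdorff_space (path_pair_space E B p)"
  unfolding Hausdorff_space_def
proof (intro allI impI)
  fix z w assume "z \<in> topspace (path_pair_space E B p) \<and> w \<in> topspace (path_pair_space E B p) \<and> z \<noteq> w"
  then have z: "z \<in> path_pairs E B p" and w: "w \<in> path_pairs E B p" and ne: "z \<noteq> w"
    by auto
  show "\<exists>U V. openin (path_pair_space E B p) U \<and> openin (path_pair_space E B p) V \<and>
      z \<in> U \<and> w \<in> V \<and> disjnt U V"
  proof (cases "fst z = fst w")
    case False
    moreover have "fst z \<in> topspace E" "fst w \<in> topspace E"
      using z w by (auto simp: path_pairs_def)
    ultimately obtain U V where "openin E U" "openin E V" "fst z \<in> U" "fst w \<in> V" "disjnt U V"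
      using E unfolding Hausdorff_space_def by metis
    then show ?thesis
      using z w
      by (intro exI[of _ "{z \<in> path_pairs E B p. fst z \<in> U}"]
                exI[of _ "{z \<in> path_pairs E B p. fst z \<in> V}"])
         (auto simp: openin_path_pair_fst disjnt_iff)
  next
    case True
    then have "snd z \<noteq> snd w"
      using ne by (simp add: prod_eq_iff)
    moreover have "snd z \<in> extensional {0..1}" "snd w \<in> extensional {0..1}"
      using z w by (auto simp: path_pairs_def)
    ultimately obtain t where t: "t \<in> {0..1}" "snd z t \<noteq> snd w t"
      by (meson extensionalityI)
    moreover have "snd z t \<in> topspace B" "snd w t \<in> topspace B"
      using z w t by (auto simp: path_pairs_def continuous_map_def Pi_iff)
    ultimately obtain U V where UV: "openin B U" "openin B V" "snd z t \<in> U" "snd w t \<in> V" "disjnt U V"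
      using B unfolding Hausdorff_space_def by metis
    have "openin (path_pair_space E B p) {z \<in> path_pairs E B p. \<forall>s\<in>{t}. snd z s \<in> W}"
      if "openin B W" for W
      using that t by (intro openin_path_pair_snd) auto
    then show ?thesis
      using z w UV
      by (intro exI[of _ "{z \<in> path_pairs E B p. \<forall>s\<in>{t}. snd z s \<in> U}"]
                exI[of _ "{z \<in> path_pairs E B p. \<forall>s\<in>{t}. snd z s \<in> V}"])
         (auto simp: disjnt_iff)
  qed
qed

lemma G_space_continuous_element:
  assumes "topological_group G T" "G_space G T X \<phi>" "g \<in> carrier G"
  shows "continuous_map X X (\<phi> g)"
proof -
  have "continuous_map X (prod_topology T X) (\<lambda>x. (g, x))"
    using assms by (auto simp: topological_group_def continuous_map_pairwise o_def)
  then have "continuous_map X X ((\<lambda>(g, x). \<phi> g x) \<circ> (\<lambda>x. (g, x)))"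
    using assms by (auto simp: G_space_def intro: continuous_map_compose)
  then show ?thesis
    by (simp add: o_def)
qed

lemma path_pair_action_in:
  assumes T: "topological_group G T" and E: "G_space G T E \<phi>" and B: "G_space G T B \<psi>"
    and p: "G_map G E \<phi> B \<psi> p" and g: "g \<in> carrier G" and z: "z \<in> path_pairs E B p"
  shows "path_pair_action E \<phi> B \<psi> p g z \<in> path_pairs E B p"
proof -
  have "continuous_map (top_of_set {0..1}) B (\<psi> g \<circ> snd z)"
    using z G_space_continuous_element[OF T B g]
    by (auto simp: path_pairs_def intro: continuous_map_compose)
  then have "continuous_map (top_of_set {0..1}) B (\<lambda>t\<in>{0..1}. \<psi> g (snd z t))"
    by (rule continuous_map_eq) auto
  moreover have "\<phi> g (fst z) \<in> topspace E"
    using z G_space_continuous_element[OF T E g]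
    by (auto simp: path_pairs_def continuous_map_def Pi_iff)
  moreover have "\<psi> g (snd z 0) = p (\<phi> g (fst z))"
    using z p g by (auto simp: path_pairs_def G_map_def equivariant_on_def)
  ultimately show ?thesis
    using z by (auto simp: path_pair_action_def path_pairs_def)
qed

lemma group_action_path_pairs:
  assumes T: "topological_group G T" and E: "G_space G T E \<phi>" and B: "G_space G T B \<psi>"
    and p: "G_map G E \<phi> B \<psi> p"
  shows "group_action G (path_pairs E B p) (path_pair_action E \<phi> B \<psi> p)"
proof -
  let ?a = "path_pair_action E \<phi> B \<psi> p" and ?Z = "path_pairs E B p"
  interpret group G using T by (simp add: topological_group_def)
  interpret E: group_action G "topspace E" \<phi> using E by (simp add: G_space_def)
  interpret B: group_action G "topspace B" \<psi> using B by (simp add: G_space_def)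
  have inE: "fst z \<in> topspace E" if "z \<in> ?Z" for z
    using that by (auto simp: path_pairs_def)
  have inB: "snd z t \<in> topspace B" if "z \<in> ?Z" "t \<in> {0..1}" for z t
    using that by (auto simp: path_pairs_def continuous_map_def Pi_iff)
  have mult: "?a (g \<otimes>\<^bsub>G\<^esub> h) z = ?a g (?a h z)"
    if "g \<in> carrier G" "h \<in> carrier G" "z \<in> ?Z" for g h z
    using path_pair_action_in[OF T E B p that(2,3)] that inE[OF that(3)] inB[OF that(3)]
    by (auto simp: path_pair_action_def E.composition_rule B.composition_rule
             intro!: restrict_ext)
  have one: "?a \<one>\<^bsub>G\<^esub> z = z" if "z \<in> ?Z" for z
  proof -
    have "\<phi> \<one>\<^bsub>G\<^esub> (fst z) = fst z"
      using inE[OF that] by (simp flip: E.id_eq_one)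
    moreover have "(\<lambda>t\<in>{0..1}. \<psi> \<one>\<^bsub>G\<^esub> (snd z t)) = snd z"
      using that inB[OF that]
      by (intro extensionalityI[of _ "{0..1}"]) (auto simp: path_pairs_def simp flip: B.id_eq_one)
    ultimately show ?thesis
      using that by (simp add: path_pair_action_def)
  qed
  have bij: "?a g \<in> Bij ?Z" if g: "g \<in> carrier G" for g
  proof -
    have "bij_betw (?a g) ?Z ?Z"
      using g path_pair_action_in[OF T E B p]
      by (intro bij_betw_byWitness[where f' = "?a (inv\<^bsub>G\<^esub> g)"])
         (auto simp: one simp flip: mult)
    then show ?thesis
      by (simp add: Bij_def path_pair_action_def)
  qed
  have "?a (g \<otimes>\<^bsub>G\<^esub> h) = compose ?Z (?a g) (?a h)" if "g \<in> carrier G" "h \<in> carrier G" for g h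
  proof (rule extensionalityI[of _ ?Z])
    show "?a (g \<otimes>\<^bsub>G\<^esub> h) \<in> extensional ?Z"
      by (simp add: path_pair_action_def)
  qed (use that mult in \<open>auto simp: compose_def\<close>)
  then have "group_hom G (BijGroup ?Z) ?a"
    using bij is_group group_BijGroup[of ?Z]
    by (auto simp: group_hom_def group_hom_axioms_def hom_def BijGroup_def)
  then show ?thesis
    by (simp add: group_action_def)
qed

lemma G_space_path_pair_space:
  assumes T: "topological_group G T" and E: "G_space G T E \<phi>" and B: "G_space G T B \<psi>"
    and p: "G_map G E \<phi> B \<psi> p"
  shows "G_space G T (path_pair_space E B p) (path_pair_action E \<phi> B \<psi> p)"
proof -
  let ?a = "path_pair_action E \<phi> B \<psi> p" and ?Z = "path_pair_space E B p"
  have TG: "topspace T = carrier G"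
    using T by (simp add: topological_group_def)
  have "continuous_map (prod_topology T ?Z) ?Z (\<lambda>(g, z). ?a g z)"
  proof (rule continuous_map_into_path_pair_space)
    have "continuous_map (prod_topology T ?Z) (prod_topology T E) (\<lambda>(g, z). (g, fst z))"
      using continuous_map_prod_top[of T ?Z T E "\<lambda>g. g" fst]
      by (auto simp: continuous_map_path_pair_fst)
    then have "continuous_map (prod_topology T ?Z) E ((\<lambda>(g, e). \<phi> g e) \<circ> (\<lambda>(g, z). (g, fst z)))"
      using E by (auto simp: G_space_def intro: continuous_map_compose)
    then show "continuous_map (prod_topology T ?Z) E (\<lambda>y. fst (case y of (g, z) \<Rightarrow> ?a g z))"
      by (rule continuous_map_eq) (auto simp: path_pair_action_def)
  next
    let ?I = "top_of_set {0..1::real}"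
    have "continuous_map (prod_topology ?I (prod_topology T ?Z)) T (\<lambda>w. fst (snd w))"
      using continuous_map_compose[OF continuous_map_snd continuous_map_fst]
      by (force simp: o_def)
    moreover have "continuous_map (prod_topology ?I (prod_topology T ?Z)) B
        ((\<lambda>(t, z). snd z t) \<circ> (\<lambda>w. (fst w, snd (snd w))))"
    proof (rule continuous_map_compose[OF _ continuous_map_path_pair_eval])
      have "continuous_map (prod_topology ?I (prod_topology T ?Z)) ?Z (\<lambda>w. snd (snd w))"
        using continuous_map_compose[OF continuous_map_snd continuous_map_snd]
        by (force simp: o_def)
      then show "continuous_map (prod_topology ?I (prod_topology T ?Z)) (prod_topology ?I ?Z)
          (\<lambda>w. (fst w, snd (snd w)))"
        by (intro continuous_map_pairedI continuous_map_fst)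
    qed
    ultimately have "continuous_map (prod_topology ?I (prod_topology T ?Z)) (prod_topology T B)
        (\<lambda>w. (fst (snd w), ((\<lambda>(t, z). snd z t) \<circ> (\<lambda>w. (fst w, snd (snd w)))) w))"
      by (rule continuous_map_pairedI)
    then have "continuous_map (prod_topology ?I (prod_topology T ?Z)) B
        ((\<lambda>(g, b). \<psi> g b) \<circ>
         (\<lambda>w. (fst (snd w), ((\<lambda>(t, z). snd z t) \<circ> (\<lambda>w. (fst w, snd (snd w)))) w)))"
      using B by (auto simp: G_space_def intro: continuous_map_compose)
    then show "continuous_map (prod_topology ?I (prod_topology T ?Z)) B
        (\<lambda>(t, y). snd (case y of (g, z) \<Rightarrow> ?a g z) t)"
      by (rule continuous_map_eq) (auto simp: path_pair_action_def)
  next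
    fix y assume "y \<in> topspace (prod_topology T ?Z)"
    then show "(case y of (g, z) \<Rightarrow> ?a g z) \<in> path_pairs E B p"
      using path_pair_action_in[OF T E B p] TG by auto
  qed
  then show ?thesis
    using E B group_action_path_pairs[OF T E B p]
    by (simp add: G_space_def Hausdorff_path_pair_space)
qed

theorem G_fibration_lifting:
  fixes X :: "'x topology"
  assumes T: "topological_group G T" and E: "G_space G T E \<phi>" and B: "G_space G T B \<psi>"
    and fib: "G_fibration G T E \<phi> B \<psi> p" and X: "G_space G T X \<xi>"
  shows "G_homotopy_lifting G E \<phi> B \<psi> p X \<xi>"
  unfolding G_homotopy_lifting_def
proof (intro allI impI, elim conjE)
  let ?I = "top_of_set {0..1::real}"
  let ?a = "path_pair_action E \<phi> B \<psi> p" and ?Z = "path_pair_space E B p"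
  have p: "G_map G E \<phi> B \<psi> p"
    using fib by (simp add: G_fibration_def)
  have lift: "G_homotopy_lifting G E \<phi> B \<psi> p ?Z ?a"
    using fib G_space_path_pair_space[OF T E B p] by (simp add: G_fibration_def)
  have "G_map G ?Z ?a E \<phi> fst"
    by (auto simp: G_map_def continuous_map_path_pair_fst equivariant_on_def path_pair_action_def)
  moreover have "G_homotopy G ?Z ?a B \<psi> (\<lambda>(t, z). snd z t)"
    by (auto simp: G_homotopy_def continuous_map_path_pair_eval equivariant_on_def
        path_pair_action_def)
  moreover have "\<forall>z\<in>topspace ?Z. (case (0, z) of (t, z) \<Rightarrow> snd z t) = p (fst z)"
    by (auto simp: path_pairs_def)
  ultimately obtain k where k: "G_homotopy G ?Z ?a E \<phi> k"
      "\<And>z. z \<in> path_pairs E B p \<Longrightarrow> k (0, z) = fst z"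
      "\<And>t z. t \<in> {0..1} \<Longrightarrow> z \<in> path_pairs E B p \<Longrightarrow> p (k (t, z)) = snd z t"
    using lift[unfolded G_homotopy_lifting_def, rule_format, of fst "\<lambda>(t, z). snd z t"] by auto
  fix f h
  assume f: "G_map G X \<xi> E \<phi> f" and h: "G_homotopy G X \<xi> B \<psi> h"
    and f0: "\<forall>x\<in>topspace X. h (0, x) = p (f x)"
  define F where "F x = (f x, \<lambda>t\<in>{0..1}. h (t, x))" for x
  have hc: "continuous_map (prod_topology ?I X) B h"
    using h by (simp add: G_homotopy_def)
  have F: "F x \<in> path_pairs E B p" if x: "x \<in> topspace X" for x
  proof -
    have "continuous_map ?I B (h \<circ> (\<lambda>t. (t, x)))"
      using x by (intro continuous_map_compose[OF _ hc]) (simp add: continuous_map_pairwise o_def)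
    then have "continuous_map ?I B (\<lambda>t\<in>{0..1}. h (t, x))"
      by (rule continuous_map_eq) auto
    then show ?thesis
      using f f0 x by (auto simp: F_def path_pairs_def G_map_def continuous_map_def Pi_iff)
  qed
  have Fc: "continuous_map X ?Z F"
  proof (rule continuous_map_into_path_pair_space[OF _ _ F])
    show "continuous_map X E (\<lambda>y. fst (F y))"
      using f by (simp add: F_def G_map_def)
    show "continuous_map (prod_topology ?I X) B (\<lambda>(t, y). snd (F y) t)"
      using hc by (rule continuous_map_eq) (auto simp: F_def)
  qed
  have Fe: "F (\<xi> g x) = ?a g (F x)" if "g \<in> carrier G" "x \<in> topspace X" for g x
    using that f h F[OF that(2)]
    by (auto simp: path_pair_action_def F_def G_map_def G_homotopy_def equivariant_on_def
             intro!: restrict_ext)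
  define K where "K = (\<lambda>(t, x). k (t, F x))"
  have "continuous_map (prod_topology ?I X) E (k \<circ> (\<lambda>(t, x). (t, F x)))"
  proof (rule continuous_map_compose)
    show "continuous_map (prod_topology ?I X) (prod_topology ?I ?Z) (\<lambda>(t, x). (t, F x))"
      using continuous_map_prod_top[of ?I X ?I ?Z "\<lambda>t. t" F] Fc by simp
    show "continuous_map (prod_topology ?I ?Z) E k"
      using k(1) by (simp add: G_homotopy_def)
  qed
  then have "continuous_map (prod_topology ?I X) E K"
    by (rule continuous_map_eq) (auto simp: K_def)
  moreover have "equivariant_on G (topspace X) \<xi> \<phi> (\<lambda>x. K (t, x))" if "t \<in> {0..1}" for t
    using k(1) that Fe F by (auto simp: K_def G_homotopy_def equivariant_on_def)
  ultimately have "G_homotopy G X \<xi> E \<phi> K"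
    by (simp add: G_homotopy_def)
  moreover have "\<forall>x\<in>topspace X. K (0, x) = f x"
    using k(2) F by (simp add: K_def) (simp add: F_def)
  moreover have "\<forall>t\<in>{0..1}. \<forall>x\<in>topspace X. p (K (t, x)) = h (t, x)"
    using k(3) F by (simp add: K_def) (simp add: F_def)
  ultimately show "\<exists>k. G_homotopy G X \<xi> E \<phi> k \<and> (\<forall>x\<in>topspace X. k (0, x) = f x) \<and>
      (\<forall>t\<in>{0..1}. \<forall>x\<in>topspace X. p (k (t, x)) = h (t, x))"
    by blast
qed


section \<open>Orbit spaces\<close>

definition orbit_space ::
  "('g, 'm) monoid_scheme \<Rightarrow> 'x topology \<Rightarrow> ('g \<Rightarrow> 'x \<Rightarrow> 'x) \<Rightarrow> 'x set topology" where
  "orbit_space G X \<phi> = topology (\<lambda>U. U \<subseteq> orbits G (topspace X) \<phi> \<and>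
     openin X {x \<in> topspace X. orbit G \<phi> x \<in> U})"

lemma openin_orbit_space:
  "openin (orbit_space G X \<phi>) U \<longleftrightarrow>
     U \<subseteq> orbits G (topspace X) \<phi> \<and> openin X {x \<in> topspace X. orbit G \<phi> x \<in> U}"
proof -
  have 1: "{x \<in> topspace X. orbit G \<phi> x \<in> S \<inter> S'} =
      {x \<in> topspace X. orbit G \<phi> x \<in> S} \<inter> {x \<in> topspace X. orbit G \<phi> x \<in> S'}" for S S'
    by auto
  have 2: "{x \<in> topspace X. orbit G \<phi> x \<in> \<Union>\<K>} = (\<Union>K\<in>\<K>. {x \<in> topspace X. orbit G \<phi> x \<in> K})" for \<K>
    by auto
  have "istopology (\<lambda>U. U \<subseteq> orbits G (topspace X) \<phi> \<and> openin X {x \<in> topspace X. orbit G \<phi> x \<in> U})"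
    unfolding istopology_def 1 2 by (blast intro: openin_Int openin_Union)
  then show ?thesis
    by (simp add: orbit_space_def topology_inverse')
qed

lemma topspace_orbit_space: "topspace (orbit_space G X \<phi>) = orbits G (topspace X) \<phi>"
proof -
  have "{x \<in> topspace X. orbit G \<phi> x \<in> orbits G (topspace X) \<phi>} = topspace X"
    by (auto simp: orbits_def)
  then have "openin (orbit_space G X \<phi>) (orbits G (topspace X) \<phi>)"
    by (simp add: openin_orbit_space)
  then show ?thesis
    by (meson openin_orbit_space openin_subset openin_topspace subset_antisym)
qed

lemma quotient_map_orbit: "quotient_map X (orbit_space G X \<phi>) (orbit G \<phi>)"
  unfolding quotient_map_def
  by (auto simp: topspace_orbit_space openin_orbit_space orbits_def)

definition orbit_space_map :: "('x \<Rightarrow> 'y) \<Rightarrow> 'x set \<Rightarrow> 'y set" where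
  "orbit_space_map f A = f ` A"

lemma orbit_space_map_orbit:
  assumes "equivariant_on G S \<phi> \<psi> f" "x \<in> S"
  shows "orbit_space_map f (orbit G \<phi> x) = orbit G \<psi> (f x)"
proof -
  have "f (\<phi> g x) = \<psi> g (f x)" if "g \<in> carrier G" for g
    using assms that by (simp add: equivariant_on_def)
  then show ?thesis
    by (force simp: orbit_space_map_def orbit_def image_iff)
qed


section \<open>Sectional category\<close>

text \<open>The infimum of the empty set is \<open>\<infinity>\<close> in \<^typ>\<open>enat\<close>. The spaces are not required to be
  Hausdorff here, since orbit spaces need not be.\<close>

definition secat_G ::
  "('g, 'm) monoid_scheme \<Rightarrow> 'e topology \<Rightarrow> ('g \<Rightarrow> 'e \<Rightarrow> 'e) \<Rightarrow> 'b topology \<Rightarrow> ('g \<Rightarrow> 'b \<Rightarrow> 'b) \<Rightarrow>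
   ('e \<Rightarrow> 'b) \<Rightarrow> enat" where
  "secat_G G E \<phi> B \<psi> p = Inf {enat k |k. k \<ge> 1 \<and>
     (\<exists>U :: nat \<Rightarrow> 'b set.
        (\<Union>i\<in>{1..k}. U i) = topspace B \<and>
        (\<forall>i\<in>{1..k}. openin B (U i) \<and> (\<forall>g\<in>carrier G. \<psi> g ` U i \<subseteq> U i) \<and>
           (\<exists>s. G_map G (subtopology B (U i)) \<psi> E \<phi> s \<and>
                G_homotopic G (subtopology B (U i)) \<psi> B \<psi> (p \<circ> s) (\<lambda>x. x))))}"

definition trivial_action :: "'x topology \<Rightarrow> unit \<Rightarrow> 'x \<Rightarrow> 'x" where
  "trivial_action X = (\<lambda>_. \<lambda>x\<in>topspace X. x)"

definition secat :: "'e topology \<Rightarrow> 'b topology \<Rightarrow> ('e \<Rightarrow> 'b) \<Rightarrow> enat" where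
  "secat E B p = secat_G (singleton_group ()) E (trivial_action E) B (trivial_action B) p"

lemma secat_eq:
  fixes B :: "'b topology"
  shows "secat E B p = Inf {enat k |k. k \<ge> 1 \<and>
     (\<exists>U :: nat \<Rightarrow> 'b set.
        (\<Union>i\<in>{1..k}. U i) = topspace B \<and>
        (\<forall>i\<in>{1..k}. openin B (U i) \<and>
           (\<exists>s. continuous_map (subtopology B (U i)) E s \<and>
                homotopic_with (\<lambda>_. True) (subtopology B (U i)) B (p \<circ> s) (\<lambda>x. x))))}"
proof -
  have inv: "trivial_action B g ` V \<subseteq> V" if "openin B V" for g V
    using openin_subset[OF that] by (auto simp: trivial_action_def)
  have eqv: "equivariant_on (singleton_group ()) (topspace (subtopology B V))
      (trivial_action B) (trivial_action Y) f" if "continuous_map (subtopology B V) Y f"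
    for V and Y :: "'y topology" and f
    using that by (auto simp: equivariant_on_def trivial_action_def continuous_map_def Pi_iff)
  have map: "G_map (singleton_group ()) (subtopology B V) (trivial_action B) E (trivial_action E) s
      \<longleftrightarrow> continuous_map (subtopology B V) E s" for V s
    using eqv by (auto simp: G_map_def)
  have hom: "G_homotopic (singleton_group ()) (subtopology B V) (trivial_action B) B
      (trivial_action B) f f' \<longleftrightarrow> homotopic_with (\<lambda>_. True) (subtopology B V) B f f'" for V f f'
  proof -
    have "equivariant_on (singleton_group ()) (topspace (subtopology B V))
        (trivial_action B) (trivial_action B) (\<lambda>x. h (t, x))"
      if "continuous_map (prod_topology (top_of_set {0..1::real}) (subtopology B V)) B h"
        "t \<in> {0..1}" for h t
      using eqv[OF continuous_map_o_Pair[OF that(1), of t]] that(2) by (simp add: o_def)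
    then show ?thesis
      unfolding G_homotopic_def homotopic_with_def by blast
  qed
  show ?thesis
    unfolding secat_def secat_G_def map hom
    by (intro arg_cong[of _ _ Inf] Collect_cong ex_cong conj_cong refl ball_cong)
       (simp_all add: inv)
qed

end

theory Submission
  imports Defs
begin

text \<open>
  Every datum that witnesses an upper bound for the equivariant sectional category of \<open>p\<close>
  descends to orbit spaces. An invariant open set \<open>U\<close> is saturated with respect to the orbit
  projection, so its image \<open>U/G\<close> is open and these images still cover \<open>B/G\<close>; a local
  \<open>G\<close>-section \<open>s\<close> up to homotopy induces a map \<open>U/G \<rightarrow> E/G\<close> on orbits; and a \<open>G\<close>-homotopy
  from \<open>p \<circ> s\<close> to the inclusion of \<open>U\<close> induces, stage by stage, a map
  \<open>[0,1] \<times> U/G \<rightarrow> B/G\<close>, which is a homotopy from \<open>p/G \<circ> s/G\<close> to the inclusion of \<open>U/G\<close>.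

  The only delicate point is the continuity of the induced homotopy: the product of a quotient
  map with an identity map need not be a quotient map. The orbit projection, however, is an open
  map (\<open>open_map_orbit\<close>), because the saturation of an open set is the union of its translates.
  Open maps are stable under products and under restriction to saturated sets, so \<open>[0,1] \<times> U\<close> does
  carry \<open>[0,1] \<times> U/G\<close> as a quotient (\<open>quotient_map_times_orbit\<close>).
\<close>

section \<open>The orbit projection\<close>

lemma (in group_action) orbit_eq_iff:
  assumes "x \<in> E" "y \<in> E"
  shows "orbit G \<phi> x = orbit G \<phi> y \<longleftrightarrow> y \<in> orbit G \<phi> x"
proof
  assume "y \<in> orbit G \<phi> x"
  then have "y \<in> orbit G \<phi> x \<inter> orbit G \<phi> y"
    using assms orbit_refl by blast
  then show "orbit G \<phi> x = orbit G \<phi> y"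
    using disjoint_union[of "orbit G \<phi> x" "orbit G \<phi> y"] assms by (auto simp: orbits_def)
qed (use assms orbit_refl in auto)

lemma (in group_action) orbit_preimage_image_invariant:
  assumes "U \<subseteq> E" and inv: "\<And>g. g \<in> carrier G \<Longrightarrow> \<phi> g ` U \<subseteq> U"
  shows "{x \<in> E. orbit G \<phi> x \<in> orbit G \<phi> ` U} = U"
proof -
  have "x \<in> U" if x: "x \<in> E" and u: "u \<in> U" and eq: "orbit G \<phi> x = orbit G \<phi> u" for x u
  proof -
    have "x \<in> orbit G \<phi> u"
      using orbit_refl[OF x] eq by simp
    then show ?thesis
      using inv u by (force simp: orbit_def)
  qed
  then show ?thesis
    using assms(1) by auto
qed

text \<open>The saturation of an open set \<open>W\<close> is the union of the open sets \<open>{x. \<phi> g x \<in> W}\<close>, which are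
  the translates of \<open>W\<close> by the inverses of the group elements.\<close>

lemma open_map_orbit:
  assumes T: "topological_group G T" and X: "G_space G T X \<phi>"
  shows "open_map X (orbit_space G X \<phi>) (orbit G \<phi>)"
  unfolding open_map_def
proof (intro allI impI)
  interpret group_action G "topspace X" \<phi>
    using X by (simp add: G_space_def)
  fix W assume W: "openin X W"
  have WX: "W \<subseteq> topspace X"
    using W by (rule openin_subset)
  have "{x \<in> topspace X. orbit G \<phi> x \<in> orbit G \<phi> ` W} =
      (\<Union>g\<in>carrier G. {x \<in> topspace X. \<phi> g x \<in> W})" (is "?L = ?R")
  proof (intro equalityI subsetI)
    fix x assume "x \<in> ?L"
    then obtain w where "x \<in> topspace X" "w \<in> W" "orbit G \<phi> x = orbit G \<phi> w"
      by blast
    then have "w \<in> orbit G \<phi> x"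
      using orbit_eq_iff[of x w] WX by blast
    then show "x \<in> ?R"
      using \<open>x \<in> topspace X\<close> \<open>w \<in> W\<close> by (auto simp: orbit_def)
  next
    fix x assume "x \<in> ?R"
    then obtain g where g: "g \<in> carrier G" "x \<in> topspace X" "\<phi> g x \<in> W"
      by blast
    then have "orbit G \<phi> x = orbit G \<phi> (\<phi> g x)"
      using orbit_eq_iff[of x "\<phi> g x"] WX by (auto simp: orbit_def)
    then show "x \<in> ?L"
      using g by blast
  qed
  moreover have "openin X {x \<in> topspace X. \<phi> g x \<in> W}" if "g \<in> carrier G" for g
    using G_space_continuous_element[OF T X that] W by (rule openin_continuous_map_preimage)
  ultimately show "openin (orbit_space G X \<phi>) (orbit G \<phi> ` W)"
    using WX by (auto simp: openin_orbit_space orbits_def)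
qed

lemma open_map_times:
  assumes f: "open_map X Y f"
  shows "open_map (prod_topology A X) (prod_topology A Y) (\<lambda>(a, x). (a, f x))"
  unfolding open_map_def
proof (intro allI impI)
  fix W assume W: "openin (prod_topology A X) W"
  show "openin (prod_topology A Y) ((\<lambda>(a, x). (a, f x)) ` W)"
    unfolding openin_prod_topology_alt
  proof (intro allI impI)
    fix a y assume "(a, y) \<in> (\<lambda>(a, x). (a, f x)) ` W"
    then obtain x where x: "(a, x) \<in> W" "y = f x"
      by auto
    then obtain U V where UV: "openin A U" "openin X V" "a \<in> U" "x \<in> V" "U \<times> V \<subseteq> W"
      using W unfolding openin_prod_topology_alt by meson
    then have "openin Y (f ` V)" "U \<times> f ` V \<subseteq> (\<lambda>(a, x). (a, f x)) ` W"
      using f by (auto simp: open_map_def)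
    then show "\<exists>U V. openin A U \<and> openin Y V \<and> a \<in> U \<and> y \<in> V \<and>
        U \<times> V \<subseteq> (\<lambda>(a, x). (a, f x)) ` W"
      using UV x by blast
  qed
qed

text \<open>An invariant open set is saturated, and both properties of the orbit projection survive the
  restriction to a saturated open set. In particular the orbits in \<open>U\<close> may be given the topology
  inherited from the whole orbit space: it is the quotient topology of \<open>U\<close>.\<close>

lemma orbit_projection_restricted_invariant:
  assumes T: "topological_group G T" and X: "G_space G T X \<phi>"
    and U: "openin X U" and inv: "\<And>g. g \<in> carrier G \<Longrightarrow> \<phi> g ` U \<subseteq> U"
  shows "open_map (subtopology X U) (subtopology (orbit_space G X \<phi>) (orbit G \<phi> ` U)) (orbit G \<phi>)"
    and "quotient_map (subtopology X U) (subtopology (orbit_space G X \<phi>) (orbit G \<phi> ` U)) (orbit G \<phi>)"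
proof -
  interpret group_action G "topspace X" \<phi>
    using X by (simp add: G_space_def)
  note sat = orbit_preimage_image_invariant[OF openin_subset[OF U] inv]
  have "openin (orbit_space G X \<phi>) (orbit G \<phi> ` U)"
    using open_map_orbit[OF T X] U by (simp add: open_map_def)
  then show "quotient_map (subtopology X U) (subtopology (orbit_space G X \<phi>) (orbit G \<phi> ` U))
      (orbit G \<phi>)"
    using quotient_map_restriction[OF quotient_map_orbit sat] by blast
  show "open_map (subtopology X U) (subtopology (orbit_space G X \<phi>) (orbit G \<phi> ` U)) (orbit G \<phi>)"
    using open_map_restriction[OF open_map_orbit[OF T X] sat] .
qed

text \<open>Quotient maps alone are not stable under products; openness of the orbit projection makes
  this hold for every space of parameters \<open>A\<close>.\<close>

lemma quotient_map_times_orbit: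
  assumes T: "topological_group G T" and X: "G_space G T X \<phi>"
    and U: "openin X U" and inv: "\<And>g. g \<in> carrier G \<Longrightarrow> \<phi> g ` U \<subseteq> U"
  shows "quotient_map (prod_topology A (subtopology X U))
      (prod_topology A (subtopology (orbit_space G X \<phi>) (orbit G \<phi> ` U))) (\<lambda>(a, x). (a, orbit G \<phi> x))"
proof (rule continuous_open_imp_quotient_map)
  note q = orbit_projection_restricted_invariant[OF T X U inv]
  show "continuous_map (prod_topology A (subtopology X U))
      (prod_topology A (subtopology (orbit_space G X \<phi>) (orbit G \<phi> ` U))) (\<lambda>(a, x). (a, orbit G \<phi> x))"
    using quotient_imp_continuous_map[OF q(2)]
      continuous_map_prod_top[of A "subtopology X U" A
        "subtopology (orbit_space G X \<phi>) (orbit G \<phi> ` U)" "\<lambda>a. a" "orbit G \<phi>"] by simp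
  show "open_map (prod_topology A (subtopology X U))
      (prod_topology A (subtopology (orbit_space G X \<phi>) (orbit G \<phi> ` U))) (\<lambda>(a, x). (a, orbit G \<phi> x))"
    using q(1) by (rule open_map_times)
  show "(\<lambda>(a, x). (a, orbit G \<phi> x)) ` topspace (prod_topology A (subtopology X U)) =
      topspace (prod_topology A (subtopology (orbit_space G X \<phi>) (orbit G \<phi> ` U)))"
    unfolding topspace_prod_topology
    using quotient_imp_surjective_map[OF q(2)]
    by (simp add: set_eq_iff image_iff del: topspace_subtopology)
qed


section \<open>Descent of equivariant maps and homotopies\<close>

lemma continuous_map_orbit_space_map:
  assumes T: "topological_group G T" and X: "G_space G T X \<phi>"
    and U: "openin X U" and inv: "\<And>g. g \<in> carrier G \<Longrightarrow> \<phi> g ` U \<subseteq> U"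
    and f: "G_map G (subtopology X U) \<phi> Y \<psi> f"
  shows "continuous_map (subtopology (orbit_space G X \<phi>) (orbit G \<phi> ` U)) (orbit_space G Y \<psi>)
      (orbit_space_map f)"
proof -
  have "continuous_map (subtopology X U) (orbit_space G Y \<psi>) (orbit G \<psi> \<circ> f)"
    using f quotient_imp_continuous_map[OF quotient_map_orbit]
    by (auto simp: G_map_def intro: continuous_map_compose)
  then have "continuous_map (subtopology X U) (orbit_space G Y \<psi>) (orbit_space_map f \<circ> orbit G \<phi>)"
    by (rule continuous_map_eq) (use f in \<open>auto simp: G_map_def intro!: orbit_space_map_orbit[symmetric]\<close>)
  then show ?thesis
    using continuous_compose_quotient_map_eq[OF orbit_projection_restricted_invariant(2)[OF T X U inv]]
    by blast
qed

text \<open>The induced homotopy sends an orbit at time \<open>t\<close> to its image under the \<open>t\<close>-th stage. Since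
  it is defined by images of sets, its ends are the induced maps at every argument, also
  outside the orbit space, as the definition of homotopy demands.\<close>

lemma homotopic_orbit_space_map:
  assumes T: "topological_group G T" and X: "G_space G T X \<phi>"
    and U: "openin X U" and inv: "\<And>g. g \<in> carrier G \<Longrightarrow> \<phi> g ` U \<subseteq> U"
    and hom: "G_homotopic G (subtopology X U) \<phi> Y \<psi> f f'"
  shows "homotopic_with (\<lambda>_. True) (subtopology (orbit_space G X \<phi>) (orbit G \<phi> ` U))
      (orbit_space G Y \<psi>) (orbit_space_map f) (orbit_space_map f')"
proof -
  let ?I = "top_of_set {0..1::real}"
  let ?V = "subtopology (orbit_space G X \<phi>) (orbit G \<phi> ` U)"
  obtain h where h: "continuous_map (prod_topology ?I (subtopology X U)) Y h"
      and eqv: "\<And>t. t \<in> {0..1} \<Longrightarrow> equivariant_on G (topspace (subtopology X U)) \<phi> \<psi> (\<lambda>x. h (t, x))"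
      and ends: "\<And>x. h (0, x) = f x" "\<And>x. h (1, x) = f' x"
    using hom unfolding G_homotopic_iff G_homotopy_def by auto
  define k where "k = (\<lambda>(t, A). orbit_space_map (\<lambda>x. h (t, x)) A)"
  have "continuous_map (prod_topology ?I (subtopology X U)) (orbit_space G Y \<psi>) (orbit G \<psi> \<circ> h)"
    using h quotient_imp_continuous_map[OF quotient_map_orbit] by (rule continuous_map_compose)
  then have "continuous_map (prod_topology ?I (subtopology X U)) (orbit_space G Y \<psi>)
      (k \<circ> (\<lambda>(t, x). (t, orbit G \<phi> x)))"
    by (rule continuous_map_eq)
       (auto simp: k_def intro!: orbit_space_map_orbit[OF eqv, symmetric])
  then have "continuous_map (prod_topology ?I ?V) (orbit_space G Y \<psi>) k"
    using continuous_compose_quotient_map_eq[OF quotient_map_times_orbit[OF T X U inv]] by blast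
  moreover have "k (0, A) = orbit_space_map f A" "k (1, A) = orbit_space_map f' A" for A
    by (simp_all add: k_def ends)
  ultimately show ?thesis
    unfolding homotopic_with_def by blast
qed


section \<open>Sectional category of the induced map\<close>

theorem proposition2p9:
  fixes G :: "('g, 'm) monoid_scheme" and T :: "'g topology"
    and E :: "'e topology" and \<phi> :: "'g \<Rightarrow> 'e \<Rightarrow> 'e"
    and B :: "'b topology" and \<psi> :: "'g \<Rightarrow> 'b \<Rightarrow> 'b"
    and p :: "'e \<Rightarrow> 'b"
  assumes "topological_group G T"
    and "G_space G T E \<phi>"
    and "G_space G T B \<psi>"
    and "G_fibration G T E \<phi> B \<psi> p"
  shows "secat (orbit_space G E \<phi>) (orbit_space G B \<psi>) (orbit_space_map p)
           \<le> secat_G G E \<phi> B \<psi> p"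
  unfolding secat_eq secat_G_def
proof (rule Inf_superset_mono, clarify)
  fix k :: nat and U
  assume k: "k \<ge> 1" and cover: "(\<Union>i\<in>{1..k}. U i) = topspace B"
    and U: "\<forall>i\<in>{1..k}. openin B (U i) \<and> (\<forall>g\<in>carrier G. \<psi> g ` U i \<subseteq> U i) \<and>
       (\<exists>s. G_map G (subtopology B (U i)) \<psi> E \<phi> s \<and>
            G_homotopic G (subtopology B (U i)) \<psi> B \<psi> (p \<circ> s) (\<lambda>x. x))"
  let ?V = "\<lambda>i. orbit G \<psi> ` U i"
  have "(\<Union>i\<in>{1..k}. ?V i) = topspace (orbit_space G B \<psi>)"
    using cover by (auto simp: topspace_orbit_space orbits_def simp flip: image_UN)
  moreover have "openin (orbit_space G B \<psi>) (?V i) \<and>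
      (\<exists>s. continuous_map (subtopology (orbit_space G B \<psi>) (?V i)) (orbit_space G E \<phi>) s \<and>
           homotopic_with (\<lambda>_. True) (subtopology (orbit_space G B \<psi>) (?V i)) (orbit_space G B \<psi>)
             (orbit_space_map p \<circ> s) (\<lambda>x. x))" if i: "i \<in> {1..k}" for i
  proof -
    have Ui: "openin B (U i)" and inv: "\<And>g. g \<in> carrier G \<Longrightarrow> \<psi> g ` U i \<subseteq> U i"
      using U i by auto
    obtain s where s: "G_map G (subtopology B (U i)) \<psi> E \<phi> s"
        "G_homotopic G (subtopology B (U i)) \<psi> B \<psi> (p \<circ> s) (\<lambda>x. x)"
      using U i by blast
    have "openin (orbit_space G B \<psi>) (?V i)"
      using open_map_orbit[OF assms(1,3)] Ui by (simp add: open_map_def)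
    moreover have "continuous_map (subtopology (orbit_space G B \<psi>) (?V i)) (orbit_space G E \<phi>)
        (orbit_space_map s)"
      using continuous_map_orbit_space_map[OF assms(1,3) Ui inv s(1)] by blast
    moreover have "orbit_space_map (p \<circ> s) = orbit_space_map p \<circ> orbit_space_map s"
        "orbit_space_map (\<lambda>x::'b. x) = (\<lambda>A. A)"
      by (auto simp: orbit_space_map_def fun_eq_iff)
    ultimately show ?thesis
      using homotopic_orbit_space_map[OF assms(1,3) Ui inv s(2)] by auto
  qed
  ultimately show "\<exists>k'. enat k = enat k' \<and> k' \<ge> 1 \<and>
     (\<exists>U :: nat \<Rightarrow> 'b set set.
        (\<Union>i\<in>{1..k'}. U i) = topspace (orbit_space G B \<psi>) \<and>
        (\<forall>i\<in>{1..k'}. openin (orbit_space G B \<psi>) (U i) \<and>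
           (\<exists>s. continuous_map (subtopology (orbit_space G B \<psi>) (U i)) (orbit_space G E \<phi>) s \<and>
                homotopic_with (\<lambda>_. True) (subtopology (orbit_space G B \<psi>) (U i))
                  (orbit_space G B \<psi>) (orbit_space_map p \<circ> s) (\<lambda>x. x))))"
    using k by (intro exI[of _ k] exI[of _ ?V]) blast
qed

end
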